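(* Let $\mathcal L$ be a Cartesian reverse differential category, with reverse differential $Rf:A\times B\to A$ of each $f:A\to B$. Then there is a functor $\mathcal T^*:\mathcal L\to\mathcal E\mathrm{Lens}(\mathcal L)$ sending an object $A$ to $\pi_1:A\times A\to A$ and an arrow $f:A\to B$ to $$\big(\,f\,,\ A\times A\xleftarrow{\langle\pi_1,Rf\rangle}A\times B\xrightarrow{f\times1}B\times B\,\big).$$
   Context: Composition is written diagrammatically: $f;g$ is first $f$ then $g$. **Cartesian reverse differential category** (Cockett, Cruttwell, Gallagher, Lemay, MacAdam, Plotkin, Pronk). A Cartesian left-additive category (category with finite products whose homsets are commutative monoids with $x;(f+g)=x;f+x;g$, $x;0=0$, and whose projections are additive) with an operator sending $f:A\to B$ to $Rf:A\times B\to A$ such that: (1) $R(f+g)=Rf+Rg$, $R0=0$; (2) $\langle a,b+c\rangle;Rf=\langle a,b\rangle;Rf+\langle a,c\rangle;Rf$, $\langle a,0\rangle;Rf=0$; (3) $R(1_A)=\pi_2$, $R(\pi_1)=\pi_2;\langle1,0\rangle$, $R(\pi_2)=\pi_2;\langle0,1\rangle$; (4) $R\langle f,g\rangle=(1\times\pi_1);Rf+(1\times\pi_2);Rg$, $R$ of the arrow to the terminal object is $0$; (5) $R(f;g)=\langle\pi_1,(f\times1);Rg\rangle;Rf$; and, writing $Df:=(\langle1,0\rangle\times1);R(Rf);\pi_2:A\times A\to B$, (6) $\langle1\times\pi_1,0\times\pi_2\rangle;D(Rf)=(1\times\pi_2);Rf$ on $A\times(B\times B)$; (7) $D(Df)$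 is invariant under the exchange $((a,b),(c,e))\mapsto((a,c),(b,e))$ of $(A\times A)\times(A\times A)$. **Euclidean lenses.** For a category $\mathcal L$ with binary products, $\mathcal E\mathrm{Lens}(\mathcal L)$ has as objects the first projections $\pi_1:A\times X\to A$; an arrow from $\pi_1:A\times X\to A$ to $\pi_1:B\times Y\to B$ is an $f:A\to B$ together with a span $A\times X\xleftarrow{F}A\times Y\xrightarrow{f\times1}B\times Y$ such that $F;\pi_1^{A,X}=\pi_1^{A,Y}$. The identity is given by $1_A$ and the identity span. The composite of $(f,F):(A\times X\to A)\to(B\times Y\to B)$ and $(g,G):(B\times Y\to B)\to(C\times Z\to C)$ has first component $f;g$ and span $A\times X\xleftarrow{\langle\pi_1,(f\times1);G;\pi_2\rangle;F}A\times Z\xrightarrow{(f;g)\times1}C\times Z$. *)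

theory Defs
  imports "HOL-Algebra.Group"
begin

text \<open>
  Composition is written diagrammatically throughout: \<open>f \<Zcomp> g\<close> is first \<open>f\<close>, then \<open>g\<close>.
  As in HOL-Algebra, a structure is a record and its axioms are a locale on it; operations are
  constrained only on arguments for which they make sense (composable arrows, parallel arrows, ...).
\<close>

section \<open>Categories and functors\<close>

record ('o, 'm) cat =
  Obj :: "'o set"
  Arr :: "'m set"
  Dom :: "'m \<Rightarrow> 'o"
  Cod :: "'m \<Rightarrow> 'o"
  Ident :: "'o \<Rightarrow> 'm"
  Comp :: "'m \<Rightarrow> 'm \<Rightarrow> 'm"  (infixl "\<Zcomp>\<index>" 70)

definition Hom :: "('o, 'm, 'x) cat_scheme \<Rightarrow> 'o \<Rightarrow> 'o \<Rightarrow> 'm set"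
  where "Hom C A B = {f \<in> Arr C. Dom C f = A \<and> Cod C f = B}"

locale category =
  fixes C (structure)
  assumes Dom_closed: "f \<in> Arr C \<Longrightarrow> Dom C f \<in> Obj C"
    and Cod_closed: "f \<in> Arr C \<Longrightarrow> Cod C f \<in> Obj C"
    and Ident_closed: "A \<in> Obj C \<Longrightarrow> Ident C A \<in> Hom C A A"
    and Comp_closed: "\<lbrakk>f \<in> Hom C A B; g \<in> Hom C B D\<rbrakk> \<Longrightarrow> f \<Zcomp> g \<in> Hom C A D"
    and Comp_assoc:
      "\<lbrakk>f \<in> Hom C A B; g \<in> Hom C B D; h \<in> Hom C D E\<rbrakk> \<Longrightarrow> (f \<Zcomp> g) \<Zcomp> h = f \<Zcomp> (g \<Zcomp> h)"
    and Ident_left: "f \<in> Hom C A B \<Longrightarrow> Ident C A \<Zcomp> f = f"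
    and Ident_right: "f \<in> Hom C A B \<Longrightarrow> f \<Zcomp> Ident C B = f"

locale cat_functor = source: category C + target: category D for C and D +
  fixes To and Ta
  assumes obj_closed: "A \<in> Obj C \<Longrightarrow> To A \<in> Obj D"
    and arr_closed: "f \<in> Hom C A B \<Longrightarrow> Ta f \<in> Hom D (To A) (To B)"
    and map_Ident: "A \<in> Obj C \<Longrightarrow> Ta (Ident C A) = Ident D (To A)"
    and map_Comp:
      "\<lbrakk>f \<in> Hom C A B; g \<in> Hom C B E\<rbrakk> \<Longrightarrow> Ta (f \<Zcomp>\<^bsub>C\<^esub> g) = Ta f \<Zcomp>\<^bsub>D\<^esub> Ta g"

section \<open>Products\<close>

record ('o, 'm) prod_cat = "('o, 'm) cat" +
  Prod :: "'o \<Rightarrow> 'o \<Rightarrow> 'o"  (infixr "\<times>\<^sub>o\<index>" 80)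
  Pr1 :: "'o \<Rightarrow> 'o \<Rightarrow> 'm"
  Pr2 :: "'o \<Rightarrow> 'o \<Rightarrow> 'm"
  Pairing :: "'m \<Rightarrow> 'm \<Rightarrow> 'm"  ("\<langle>_,/ _\<rangle>\<index>")

locale category_with_binary_products = category L for L (structure) +
  assumes Prod_closed: "\<lbrakk>A \<in> Obj L; B \<in> Obj L\<rbrakk> \<Longrightarrow> A \<times>\<^sub>o B \<in> Obj L"
    and Pr1_closed: "\<lbrakk>A \<in> Obj L; B \<in> Obj L\<rbrakk> \<Longrightarrow> Pr1 L A B \<in> Hom L (A \<times>\<^sub>o B) A"
    and Pr2_closed: "\<lbrakk>A \<in> Obj L; B \<in> Obj L\<rbrakk> \<Longrightarrow> Pr2 L A B \<in> Hom L (A \<times>\<^sub>o B) B"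
    and Pairing_closed:
      "\<lbrakk>f \<in> Hom L X A; g \<in> Hom L X B\<rbrakk> \<Longrightarrow> \<langle>f, g\<rangle> \<in> Hom L X (A \<times>\<^sub>o B)"
    and Pairing_Pr1: "\<lbrakk>f \<in> Hom L X A; g \<in> Hom L X B\<rbrakk> \<Longrightarrow> \<langle>f, g\<rangle> \<Zcomp> Pr1 L A B = f"
    and Pairing_Pr2: "\<lbrakk>f \<in> Hom L X A; g \<in> Hom L X B\<rbrakk> \<Longrightarrow> \<langle>f, g\<rangle> \<Zcomp> Pr2 L A B = g"
    and Pairing_unique:
      "\<lbrakk>A \<in> Obj L; B \<in> Obj L; h \<in> Hom L X (A \<times>\<^sub>o B);
        h \<Zcomp> Pr1 L A B = f; h \<Zcomp> Pr2 L A B = g\<rbrakk> \<Longrightarrow> h = \<langle>f, g\<rangle>"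

definition prod_arr :: "('o, 'm, 'x) prod_cat_scheme \<Rightarrow> 'm \<Rightarrow> 'm \<Rightarrow> 'm"  (infixr "\<times>\<^sub>m\<index>" 80)
  where "f \<times>\<^sub>m\<^bsub>L\<^esub> g =
    \<langle>Pr1 L (Dom L f) (Dom L g) \<Zcomp>\<^bsub>L\<^esub> f, Pr2 L (Dom L f) (Dom L g) \<Zcomp>\<^bsub>L\<^esub> g\<rangle>\<^bsub>L\<^esub>"

record ('o, 'm) cartesian_cat = "('o, 'm) prod_cat" +
  Terminal :: 'o
  Bang :: "'o \<Rightarrow> 'm"

locale cartesian_category = category_with_binary_products L for L (structure) +
  assumes Terminal_closed: "Terminal L \<in> Obj L"
    and Bang_closed: "A \<in> Obj L \<Longrightarrow> Bang L A \<in> Hom L A (Terminal L)"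
    and Bang_unique: "f \<in> Hom L A (Terminal L) \<Longrightarrow> f = Bang L A"

section \<open>Cartesian left-additive categories\<close>

record ('o, 'm) left_additive_cat = "('o, 'm) cartesian_cat" +
  Plus :: "'m \<Rightarrow> 'm \<Rightarrow> 'm"  (infixl "\<oplus>\<index>" 65)
  Zero :: "'o \<Rightarrow> 'o \<Rightarrow> 'm"

definition additive_arr :: "('o, 'm, 'x) left_additive_cat_scheme \<Rightarrow> 'm \<Rightarrow> bool"
  where "additive_arr L h \<longleftrightarrow>
    (\<forall>X \<in> Obj L.
      (\<forall>f \<in> Hom L X (Dom L h). \<forall>g \<in> Hom L X (Dom L h).
        (f \<oplus>\<^bsub>L\<^esub> g) \<Zcomp>\<^bsub>L\<^esub> h = f \<Zcomp>\<^bsub>L\<^esub> h \<oplus>\<^bsub>L\<^esub> g \<Zcomp>\<^bsub>L\<^esub> h) \<and>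
      Zero L X (Dom L h) \<Zcomp>\<^bsub>L\<^esub> h = Zero L X (Cod L h))"

locale cartesian_left_additive_category = cartesian_category L for L (structure) +
  assumes Hom_comm_monoid:
      "\<lbrakk>A \<in> Obj L; B \<in> Obj L\<rbrakk> \<Longrightarrow>
        comm_monoid \<lparr>carrier = Hom L A B, mult = Plus L, one = Zero L A B\<rparr>"
    and Comp_Plus:
      "\<lbrakk>x \<in> Hom L X A; f \<in> Hom L A B; g \<in> Hom L A B\<rbrakk> \<Longrightarrow> x \<Zcomp> (f \<oplus> g) = x \<Zcomp> f \<oplus> x \<Zcomp> g"
    and Comp_Zero: "\<lbrakk>x \<in> Hom L X A; B \<in> Obj L\<rbrakk> \<Longrightarrow> x \<Zcomp> Zero L A B = Zero L X B"
    and Pr1_additive: "\<lbrakk>A \<in> Obj L; B \<in> Obj L\<rbrakk> \<Longrightarrow> additive_arr L (Pr1 L A B)"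
    and Pr2_additive: "\<lbrakk>A \<in> Obj L; B \<in> Obj L\<rbrakk> \<Longrightarrow> additive_arr L (Pr2 L A B)"

section \<open>Cartesian reverse differential categories\<close>

record ('o, 'm) reverse_diff_cat = "('o, 'm) left_additive_cat" +
  Rev :: "'m \<Rightarrow> 'm"

text \<open>
  For \<open>f : A \<rightarrow> B\<close> we have \<open>R f : A \<times> B \<rightarrow> A\<close> and \<open>R (R f) : (A \<times> B) \<times> A \<rightarrow> A \<times> B\<close>, so the
  forward derivative is \<open>D f : A \<times> A \<rightarrow> (A \<times> B) \<times> A \<rightarrow> A \<times> B \<rightarrow> B\<close>.
\<close>
definition Fwd :: "('o, 'm, 'x) reverse_diff_cat_scheme \<Rightarrow> 'm \<Rightarrow> 'm"
  where "Fwd L f = (let A = Dom L f; B = Cod L f in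
    (\<langle>Ident L A, Zero L A B\<rangle>\<^bsub>L\<^esub> \<times>\<^sub>m\<^bsub>L\<^esub> Ident L A) \<Zcomp>\<^bsub>L\<^esub> Rev L (Rev L f) \<Zcomp>\<^bsub>L\<^esub> Pr2 L A B)"

text \<open>The exchange \<open>((a, b), (c, e)) \<mapsto> ((a, c), (b, e))\<close> of \<open>(A \<times> A) \<times> (A \<times> A)\<close>.\<close>
definition Exchange :: "('o, 'm, 'x) prod_cat_scheme \<Rightarrow> 'o \<Rightarrow> 'm"
  where "Exchange L A = \<langle>Pr1 L A A \<times>\<^sub>m\<^bsub>L\<^esub> Pr1 L A A, Pr2 L A A \<times>\<^sub>m\<^bsub>L\<^esub> Pr2 L A A\<rangle>\<^bsub>L\<^esub>"

locale cartesian_reverse_differential_category =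
  cartesian_left_additive_category L for L (structure) +
  assumes Rev_closed: "f \<in> Hom L A B \<Longrightarrow> Rev L f \<in> Hom L (A \<times>\<^sub>o B) A"
    and Rev_Plus:
      "\<lbrakk>f \<in> Hom L A B; g \<in> Hom L A B\<rbrakk> \<Longrightarrow> Rev L (f \<oplus> g) = Rev L f \<oplus> Rev L g"
    and Rev_Zero:
      "\<lbrakk>A \<in> Obj L; B \<in> Obj L\<rbrakk> \<Longrightarrow> Rev L (Zero L A B) = Zero L (A \<times>\<^sub>o B) A"
    and Rev_additive_Plus:
      "\<lbrakk>f \<in> Hom L A B; a \<in> Hom L X A; b \<in> Hom L X B; c \<in> Hom L X B\<rbrakk> \<Longrightarrow>
        \<langle>a, b \<oplus> c\<rangle> \<Zcomp> Rev L f = \<langle>a, b\<rangle> \<Zcomp> Rev L f \<oplus> \<langle>a, c\<rangle> \<Zcomp> Rev L f"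
    and Rev_additive_Zero:
      "\<lbrakk>f \<in> Hom L A B; a \<in> Hom L X A\<rbrakk> \<Longrightarrow> \<langle>a, Zero L X B\<rangle> \<Zcomp> Rev L f = Zero L X A"
    and Rev_Ident: "A \<in> Obj L \<Longrightarrow> Rev L (Ident L A) = Pr2 L A A"
    and Rev_Pr1:
      "\<lbrakk>A \<in> Obj L; B \<in> Obj L\<rbrakk> \<Longrightarrow>
        Rev L (Pr1 L A B) = Pr2 L (A \<times>\<^sub>o B) A \<Zcomp> \<langle>Ident L A, Zero L A B\<rangle>"
    and Rev_Pr2:
      "\<lbrakk>A \<in> Obj L; B \<in> Obj L\<rbrakk> \<Longrightarrow>
        Rev L (Pr2 L A B) = Pr2 L (A \<times>\<^sub>o B) B \<Zcomp> \<langle>Zero L B A, Ident L B\<rangle>"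
    and Rev_Pairing:
      "\<lbrakk>f \<in> Hom L X A; g \<in> Hom L X B\<rbrakk> \<Longrightarrow>
        Rev L \<langle>f, g\<rangle> =
          (Ident L X \<times>\<^sub>m Pr1 L A B) \<Zcomp> Rev L f \<oplus> (Ident L X \<times>\<^sub>m Pr2 L A B) \<Zcomp> Rev L g"
    and Rev_Bang: "A \<in> Obj L \<Longrightarrow> Rev L (Bang L A) = Zero L (A \<times>\<^sub>o Terminal L) A"
    and Rev_Comp:
      "\<lbrakk>f \<in> Hom L A B; g \<in> Hom L B E\<rbrakk> \<Longrightarrow>
        Rev L (f \<Zcomp> g) = \<langle>Pr1 L A E, (f \<times>\<^sub>m Ident L E) \<Zcomp> Rev L g\<rangle> \<Zcomp> Rev L f"
    and Fwd_Rev: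
      "f \<in> Hom L A B \<Longrightarrow>
        \<langle>Ident L A \<times>\<^sub>m Pr1 L B B, Zero L A A \<times>\<^sub>m Pr2 L B B\<rangle> \<Zcomp> Fwd L (Rev L f) =
          (Ident L A \<times>\<^sub>m Pr2 L B B) \<Zcomp> Rev L f"
    and Fwd_Fwd_Exchange:
      "f \<in> Hom L A B \<Longrightarrow> Exchange L A \<Zcomp> Fwd L (Fwd L f) = Fwd L (Fwd L f)"

section \<open>Euclidean lenses\<close>

text \<open>
  The first projection \<open>\<pi>\<^sub>1 : A \<times> X \<rightarrow> A\<close> is recorded together with its base \<open>A\<close> and fibre \<open>X\<close>,
  which the bare arrow need not determine but which composition of lenses refers to.
\<close>
record ('o, 'm) trivial_bundle =
  base :: 'o
  fibre :: 'o
  proj :: 'm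

definition first_projection ::
    "('o, 'm, 'x) prod_cat_scheme \<Rightarrow> 'o \<Rightarrow> 'o \<Rightarrow> ('o, 'm) trivial_bundle"
  where "first_projection L A X = \<lparr>base = A, fibre = X, proj = Pr1 L A X\<rparr>"

text \<open>
  The lens given by \<open>f : A \<rightarrow> B\<close> and the span \<open>A \<times> X \<leftarrow> A \<times> Y \<rightarrow> B \<times> Y\<close> with legs \<open>F\<close> and \<open>f \<times> 1\<close>
  also records its source and target bundles. The right leg is determined by \<open>f\<close> and \<open>Y\<close>.
\<close>
record ('o, 'm) lens =
  lens_src :: "('o, 'm) trivial_bundle"
  lens_tgt :: "('o, 'm) trivial_bundle"
  lens_base :: 'm
  lens_left :: 'm
  lens_right :: 'm

definition lens_arr :: "('o, 'm, 'x) prod_cat_scheme \<Rightarrow> ('o, 'm) lens set"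
  where "lens_arr L =
    {\<lparr>lens_src = first_projection L A X, lens_tgt = first_projection L B Y,
      lens_base = f, lens_left = F, lens_right = f \<times>\<^sub>m\<^bsub>L\<^esub> Ident L Y\<rparr> | A X B Y f F.
      A \<in> Obj L \<and> X \<in> Obj L \<and> B \<in> Obj L \<and> Y \<in> Obj L \<and>
      f \<in> Hom L A B \<and> F \<in> Hom L (A \<times>\<^sub>o\<^bsub>L\<^esub> Y) (A \<times>\<^sub>o\<^bsub>L\<^esub> X) \<and>
      F \<Zcomp>\<^bsub>L\<^esub> Pr1 L A X = Pr1 L A Y}"

definition lens_ident ::
    "('o, 'm, 'x) prod_cat_scheme \<Rightarrow> ('o, 'm) trivial_bundle \<Rightarrow> ('o, 'm) lens"
  where "lens_ident L p =
    \<lparr>lens_src = p, lens_tgt = p, lens_base = Ident L (base p),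
     lens_left = Ident L (base p \<times>\<^sub>o\<^bsub>L\<^esub> fibre p),
     lens_right = Ident L (base p \<times>\<^sub>o\<^bsub>L\<^esub> fibre p)\<rparr>"

definition lens_comp ::
    "('o, 'm, 'x) prod_cat_scheme \<Rightarrow> ('o, 'm) lens \<Rightarrow> ('o, 'm) lens \<Rightarrow> ('o, 'm) lens"
  where "lens_comp L \<phi> \<psi> =
    (let A = base (lens_src \<phi>);
         B = base (lens_src \<psi>); Y = fibre (lens_src \<psi>);
         Z = fibre (lens_tgt \<psi>);
         f = lens_base \<phi>; F = lens_left \<phi>; g = lens_base \<psi>; G = lens_left \<psi>
     in \<lparr>lens_src = lens_src \<phi>, lens_tgt = lens_tgt \<psi>,
         lens_base = f \<Zcomp>\<^bsub>L\<^esub> g,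
         lens_left =
           \<langle>Pr1 L A Z, (f \<times>\<^sub>m\<^bsub>L\<^esub> Ident L Z) \<Zcomp>\<^bsub>L\<^esub> G \<Zcomp>\<^bsub>L\<^esub> Pr2 L B Y\<rangle>\<^bsub>L\<^esub> \<Zcomp>\<^bsub>L\<^esub> F,
         lens_right = (f \<Zcomp>\<^bsub>L\<^esub> g) \<times>\<^sub>m\<^bsub>L\<^esub> Ident L Z\<rparr>)"

definition ELens :: "('o, 'm, 'x) prod_cat_scheme \<Rightarrow> (('o, 'm) trivial_bundle, ('o, 'm) lens) cat"
  where "ELens L =
    \<lparr>Obj = {first_projection L A X | A X. A \<in> Obj L \<and> X \<in> Obj L},
     Arr = lens_arr L, Dom = lens_src, Cod = lens_tgt,
     Ident = lens_ident L, Comp = lens_comp L\<rparr>"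

end

theory Submission
  imports Defs
begin

text \<open>
  The left leg \<open>F\<close> of a Euclidean lens commutes with the projections to the base, so a lens from
  \<open>A \<times> X\<close> to \<open>B \<times> Y\<close> amounts to a forward arrow \<open>f : A \<rightarrow> B\<close> and a backward arrow
  \<open>\<phi> : A \<times> Y \<rightarrow> X\<close>, with \<open>F = \<langle>\<pi>\<^sub>1, \<phi>\<rangle>\<close>. In these terms the composite of \<open>(f, \<phi>)\<close> and \<open>(g, \<psi>)\<close>
  has the backward arrow \<open>\<langle>\<pi>\<^sub>1, (f \<times> 1); \<psi>\<rangle>; \<phi>\<close>. For \<open>\<phi> = R f\<close> and \<open>\<psi> = R g\<close> this is the right-hand
  side of the reverse chain rule \<open>Rev_Comp\<close>, so preservation of composites is that axiom
  (\<open>cotangent_lens_Comp\<close>). Likewise the identity lens has the backward arrow \<open>\<pi>\<^sub>2\<close>, which is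
  \<open>R 1\<close> by \<open>Rev_Ident\<close>.

  What remains is that Euclidean lenses form a category (\<open>ELens_category\<close>). The unit and
  associativity laws reduce to equations between arrows into a product, which the rules
  \<open>comp_Pairing\<close> and \<open>Pairing_prod_arr\<close> bring to a common form.
\<close>

section \<open>Calculus of pairings\<close>

context category
begin

lemma Hom_objs:
  assumes "f \<in> Hom C A B"
  shows "A \<in> Obj C" and "B \<in> Obj C"
  using assms Dom_closed Cod_closed by (auto simp: Hom_def)

end

context category_with_binary_products
begin

lemma comp_Pairing:
  assumes h: "h \<in> Hom L Y X" and f: "f \<in> Hom L X A" and g: "g \<in> Hom L X B"
  shows "h \<Zcomp> \<langle>f, g\<rangle> = \<langle>h \<Zcomp> f, h \<Zcomp> g\<rangle>"
proof (rule Pairing_unique)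
  show A: "A \<in> Obj L" and B: "B \<in> Obj L"
    using Hom_objs f g by auto
  have p: "\<langle>f, g\<rangle> \<in> Hom L X (A \<times>\<^sub>o B)"
    by (rule Pairing_closed[OF f g])
  show "h \<Zcomp> \<langle>f, g\<rangle> \<in> Hom L Y (A \<times>\<^sub>o B)"
    by (rule Comp_closed[OF h p])
  show "h \<Zcomp> \<langle>f, g\<rangle> \<Zcomp> Pr1 L A B = h \<Zcomp> f"
    by (simp add: Comp_assoc[OF h p Pr1_closed[OF A B]] Pairing_Pr1[OF f g])
  show "h \<Zcomp> \<langle>f, g\<rangle> \<Zcomp> Pr2 L A B = h \<Zcomp> g"
    by (simp add: Comp_assoc[OF h p Pr2_closed[OF A B]] Pairing_Pr2[OF f g])
qed

lemma Pairing_Pr1_Pr2: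
  assumes "A \<in> Obj L" "B \<in> Obj L"
  shows "\<langle>Pr1 L A B, Pr2 L A B\<rangle> = Ident L (A \<times>\<^sub>o B)"
  using Pairing_unique[OF assms Ident_closed[OF Prod_closed[OF assms]] refl refl]
  by (simp add: Ident_left[OF Pr1_closed[OF assms]] Ident_left[OF Pr2_closed[OF assms]])

lemma prod_arr_Pairing:
  assumes "f \<in> Hom L A B" "g \<in> Hom L A' B'"
  shows "f \<times>\<^sub>m g = \<langle>Pr1 L A A' \<Zcomp> f, Pr2 L A A' \<Zcomp> g\<rangle>"
  using assms by (simp add: prod_arr_def Hom_def)

lemma prod_arr_closed:
  assumes f: "f \<in> Hom L A B" and g: "g \<in> Hom L A' B'"
  shows "f \<times>\<^sub>m g \<in> Hom L (A \<times>\<^sub>o A') (B \<times>\<^sub>o B')"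
  unfolding prod_arr_Pairing[OF f g]
  using Hom_objs[OF f] Hom_objs[OF g]
  by (intro Pairing_closed Comp_closed[OF Pr1_closed f] Comp_closed[OF Pr2_closed g])

lemma prod_arr_Pr1:
  assumes f: "f \<in> Hom L A B" and g: "g \<in> Hom L A' B'"
  shows "(f \<times>\<^sub>m g) \<Zcomp> Pr1 L B B' = Pr1 L A A' \<Zcomp> f"
  unfolding prod_arr_Pairing[OF f g]
  by (rule Pairing_Pr1[OF
        Comp_closed[OF Pr1_closed[OF Hom_objs(1)[OF f] Hom_objs(1)[OF g]] f]
        Comp_closed[OF Pr2_closed[OF Hom_objs(1)[OF f] Hom_objs(1)[OF g]] g]])

lemma prod_arr_Pr2:
  assumes f: "f \<in> Hom L A B" and g: "g \<in> Hom L A' B'"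
  shows "(f \<times>\<^sub>m g) \<Zcomp> Pr2 L B B' = Pr2 L A A' \<Zcomp> g"
  unfolding prod_arr_Pairing[OF f g]
  by (rule Pairing_Pr2[OF
        Comp_closed[OF Pr1_closed[OF Hom_objs(1)[OF f] Hom_objs(1)[OF g]] f]
        Comp_closed[OF Pr2_closed[OF Hom_objs(1)[OF f] Hom_objs(1)[OF g]] g]])

lemma Pairing_prod_arr:
  assumes a: "a \<in> Hom L X A" and b: "b \<in> Hom L X A'"
    and f: "f \<in> Hom L A B" and g: "g \<in> Hom L A' B'"
  shows "\<langle>a, b\<rangle> \<Zcomp> (f \<times>\<^sub>m g) = \<langle>a \<Zcomp> f, b \<Zcomp> g\<rangle>"
proof -
  note p1 = Pr1_closed[OF Hom_objs(2)[OF a] Hom_objs(2)[OF b]]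
    and p2 = Pr2_closed[OF Hom_objs(2)[OF a] Hom_objs(2)[OF b]]
    and ab = Pairing_closed[OF a b]
  show ?thesis
    by (simp add: prod_arr_Pairing[OF f g] comp_Pairing[OF ab Comp_closed[OF p1 f] Comp_closed[OF p2 g]]
        Comp_assoc[OF ab p1 f, symmetric] Comp_assoc[OF ab p2 g, symmetric]
        Pairing_Pr1[OF a b] Pairing_Pr2[OF a b])
qed

lemma prod_arr_Ident:
  assumes A: "A \<in> Obj L" and B: "B \<in> Obj L"
  shows "Ident L A \<times>\<^sub>m Ident L B = Ident L (A \<times>\<^sub>o B)"
  by (simp add: prod_arr_Pairing[OF Ident_closed[OF A] Ident_closed[OF B]]
      Ident_right[OF Pr1_closed[OF A B]] Ident_right[OF Pr2_closed[OF A B]]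
      Pairing_Pr1_Pr2[OF A B])

lemma prod_arr_Ident_Comp:
  assumes f: "f \<in> Hom L A B" and g: "g \<in> Hom L B E" and Z: "Z \<in> Obj L"
  shows "(f \<times>\<^sub>m Ident L Z) \<Zcomp> (g \<times>\<^sub>m Ident L Z) = (f \<Zcomp> g) \<times>\<^sub>m Ident L Z"
proof -
  note A = Hom_objs(1)[OF f] and i = Ident_closed[OF Z]
  note p1 = Pr1_closed[OF A Z] and p2 = Pr2_closed[OF A Z]
  show ?thesis
    by (simp add: prod_arr_Pairing[OF f i] prod_arr_Pairing[OF Comp_closed[OF f g] i]
        Pairing_prod_arr[OF Comp_closed[OF p1 f] Comp_closed[OF p2 i] g i]
        Comp_assoc[OF p1 f g] Comp_assoc[OF p2 i i] Ident_left[OF i])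
qed

end

section \<open>The category of Euclidean lenses\<close>

definition span_lens ::
    "('o, 'm, 'x) prod_cat_scheme \<Rightarrow> 'o \<Rightarrow> 'o \<Rightarrow> 'o \<Rightarrow> 'o \<Rightarrow> 'm \<Rightarrow> 'm \<Rightarrow> ('o, 'm) lens"
  where "span_lens L A X B Y f F =
    \<lparr>lens_src = first_projection L A X, lens_tgt = first_projection L B Y,
     lens_base = f, lens_left = F, lens_right = f \<times>\<^sub>m\<^bsub>L\<^esub> Ident L Y\<rparr>"

text \<open>
  The left leg of a composite lens, taken apart from the lens record so that the laws of a category
  become equations between arrows of the underlying category.
\<close>
definition left_comp ::
    "('o, 'm, 'x) prod_cat_scheme \<Rightarrow> 'o \<Rightarrow> 'o \<Rightarrow> 'o \<Rightarrow> 'o \<Rightarrow> 'm \<Rightarrow> 'm \<Rightarrow> 'm \<Rightarrow> 'm"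
  where "left_comp L A B Y Z f F G =
    \<langle>Pr1 L A Z, (f \<times>\<^sub>m\<^bsub>L\<^esub> Ident L Z) \<Zcomp>\<^bsub>L\<^esub> G \<Zcomp>\<^bsub>L\<^esub> Pr2 L B Y\<rangle>\<^bsub>L\<^esub> \<Zcomp>\<^bsub>L\<^esub> F"

definition left_legs :: "('o, 'm, 'x) prod_cat_scheme \<Rightarrow> 'o \<Rightarrow> 'o \<Rightarrow> 'o \<Rightarrow> 'm set"
  where "left_legs L A X Y =
    {F \<in> Hom L (A \<times>\<^sub>o\<^bsub>L\<^esub> Y) (A \<times>\<^sub>o\<^bsub>L\<^esub> X). F \<Zcomp>\<^bsub>L\<^esub> Pr1 L A X = Pr1 L A Y}"

lemma span_lens_Comp:
  "span_lens L A X B Y f F \<Zcomp>\<^bsub>ELens L\<^esub> span_lens L B Y E Z g G =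
    span_lens L A X E Z (f \<Zcomp>\<^bsub>L\<^esub> g) (left_comp L A B Y Z f F G)"
  by (simp add: ELens_def lens_comp_def span_lens_def left_comp_def first_projection_def)

lemma Obj_ELens: "p \<in> Obj (ELens L) \<longleftrightarrow> (\<exists>A\<in>Obj L. \<exists>X\<in>Obj L. p = first_projection L A X)"
  by (auto simp: ELens_def)

context category_with_binary_products
begin

lemma first_projection_in_ELens:
  assumes "A \<in> Obj L" "X \<in> Obj L"
  shows "first_projection L A X \<in> Obj (ELens L)"
  using assms by (auto simp: Obj_ELens)

lemma span_lens_in_Hom:
  assumes "A \<in> Obj L" "X \<in> Obj L" "B \<in> Obj L" "Y \<in> Obj L"
    and "f \<in> Hom L A B" "F \<in> left_legs L A X Y"
  shows "span_lens L A X B Y f F \<in> Hom (ELens L) (first_projection L A X) (first_projection L B Y)"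
proof -
  have "span_lens L A X B Y f F \<in> lens_arr L"
    using assms by (auto simp: lens_arr_def span_lens_def left_legs_def)
  then show ?thesis
    by (simp add: Hom_def) (simp add: ELens_def span_lens_def)
qed

lemma ELens_Arr_cases:
  assumes "\<phi> \<in> Arr (ELens L)"
  obtains A X B Y f F where "A \<in> Obj L" "X \<in> Obj L" "B \<in> Obj L" "Y \<in> Obj L"
    "f \<in> Hom L A B" "F \<in> left_legs L A X Y" "\<phi> = span_lens L A X B Y f F"
  using assms by (auto simp: ELens_def lens_arr_def span_lens_def left_legs_def)

lemma ELens_Hom_cases:
  assumes "\<phi> \<in> Hom (ELens L) p q"
  obtains A X B Y f F where "A \<in> Obj L" "X \<in> Obj L" "B \<in> Obj L" "Y \<in> Obj L"
    "p = first_projection L A X" "q = first_projection L B Y"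
    "f \<in> Hom L A B" "F \<in> left_legs L A X Y" "\<phi> = span_lens L A X B Y f F"
proof -
  have arr: "\<phi> \<in> Arr (ELens L)" and ends: "lens_src \<phi> = p" "lens_tgt \<phi> = q"
    using assms by (auto simp: Hom_def ELens_def)
  show thesis
    using ELens_Arr_cases[OF arr] ends that by (metis lens.select_convs(1,2) span_lens_def)
qed

lemma left_legs_Ident:
  assumes "A \<in> Obj L" "X \<in> Obj L"
  shows "Ident L (A \<times>\<^sub>o X) \<in> left_legs L A X X"
  using assms Ident_left[OF Pr1_closed] Ident_closed[OF Prod_closed] by (simp add: left_legs_def)

lemma ELens_Ident:
  assumes "A \<in> Obj L" "X \<in> Obj L"
  shows "Ident (ELens L) (first_projection L A X) =
    span_lens L A X A X (Ident L A) (Ident L (A \<times>\<^sub>o X))"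
  by (simp add: ELens_def lens_ident_def span_lens_def first_projection_def
      prod_arr_Ident[OF assms])

lemma left_comp_closed:
  assumes A: "A \<in> Obj L" and X: "X \<in> Obj L" and Y: "Y \<in> Obj L" and Z: "Z \<in> Obj L"
    and f: "f \<in> Hom L A B" and F: "F \<in> left_legs L A X Y" and G: "G \<in> left_legs L B Y Z"
  shows "left_comp L A B Y Z f F G \<in> left_legs L A X Z"
proof -
  note B = Hom_objs(2)[OF f]
  have F': "F \<in> Hom L (A \<times>\<^sub>o Y) (A \<times>\<^sub>o X)" and F1: "F \<Zcomp> Pr1 L A X = Pr1 L A Y"
    and G': "G \<in> Hom L (B \<times>\<^sub>o Z) (B \<times>\<^sub>o Y)"
    using F G by (auto simp: left_legs_def)
  let ?b = "(f \<times>\<^sub>m Ident L Z) \<Zcomp> G \<Zcomp> Pr2 L B Y"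
  have b: "?b \<in> Hom L (A \<times>\<^sub>o Z) Y"
    by (rule Comp_closed[OF Comp_closed[OF prod_arr_closed[OF f Ident_closed[OF Z]] G']
          Pr2_closed[OF B Y]])
  note p1 = Pr1_closed[OF A Z]
  note p = Pairing_closed[OF p1 b]
  show ?thesis
    using Comp_closed[OF p F']
    by (simp add: left_legs_def left_comp_def Comp_assoc[OF p F' Pr1_closed[OF A X]] F1
        Pairing_Pr1[OF p1 b])
qed

text \<open>
  Composition keeps only the backward part \<open>F; \<pi>\<^sub>2\<close> of its second left leg, and the condition
  \<open>F; \<pi>\<^sub>1 = \<pi>\<^sub>1\<close> makes this part determine \<open>F\<close>.
\<close>
lemma left_comp_Ident_left:
  assumes A: "A \<in> Obj L" and X: "X \<in> Obj L" and Y: "Y \<in> Obj L" and F: "F \<in> left_legs L A X Y"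
  shows "left_comp L A A X Y (Ident L A) (Ident L (A \<times>\<^sub>o X)) F = F"
proof -
  have F': "F \<in> Hom L (A \<times>\<^sub>o Y) (A \<times>\<^sub>o X)" and F1: "F \<Zcomp> Pr1 L A X = Pr1 L A Y"
    using F by (auto simp: left_legs_def)
  have "F = \<langle>Pr1 L A Y, F \<Zcomp> Pr2 L A X\<rangle>"
    using Pairing_unique[OF A X F' F1 refl] .
  then show ?thesis
    using F' by (simp add: left_comp_def prod_arr_Ident[OF A Y] Ident_left[OF F']
        Ident_right[OF F'])
qed

lemma left_comp_Ident_right:
  assumes A: "A \<in> Obj L" and Y: "Y \<in> Obj L"
    and f: "f \<in> Hom L A B" and F: "F \<in> left_legs L A X Y"
  shows "left_comp L A B Y Y f F (Ident L (B \<times>\<^sub>o Y)) = F"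
proof -
  note B = Hom_objs(2)[OF f] and i = Ident_closed[OF Y]
  have F': "F \<in> Hom L (A \<times>\<^sub>o Y) (A \<times>\<^sub>o X)"
    using F by (auto simp: left_legs_def)
  show ?thesis
    by (simp add: left_comp_def Ident_right[OF prod_arr_closed[OF f i]] prod_arr_Pr2[OF f i]
        Ident_right[OF Pr2_closed[OF A Y]] Pairing_Pr1_Pr2[OF A Y] Ident_left[OF F'])
qed

text \<open>
  Both composites send \<open>(a, w)\<close> to \<open>F (a, y)\<close>, where \<open>w\<close> is carried back along \<open>H\<close> at \<open>g (f a)\<close> and
  then along \<open>G\<close> at \<open>f a\<close> to give \<open>y\<close>. The two bracketings carry \<open>w\<close> back before and after the
  change of base along \<open>f\<close>, and the proof compares \<open>\<langle>\<pi>\<^sub>1, k\<rangle>; (f \<times> 1)\<close> with \<open>(f \<times> 1); \<langle>\<pi>\<^sub>1, h\<rangle>\<close>,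
  where \<open>h = (g \<times> 1); H; \<pi>\<^sub>2\<close> and \<open>k = (f; g \<times> 1); H; \<pi>\<^sub>2\<close>: both are \<open>\<langle>\<pi>\<^sub>1; f, k\<rangle>\<close>.
\<close>
lemma left_comp_assoc:
  assumes A: "A \<in> Obj L" and X: "X \<in> Obj L" and Y: "Y \<in> Obj L" and Z: "Z \<in> Obj L"
    and W: "W \<in> Obj L"
    and f: "f \<in> Hom L A B" and g: "g \<in> Hom L B E"
    and F: "F \<in> left_legs L A X Y" and G: "G \<in> left_legs L B Y Z" and H: "H \<in> left_legs L E Z W"
  shows "left_comp L A E Z W (f \<Zcomp> g) (left_comp L A B Y Z f F G) H =
    left_comp L A B Y W f F (left_comp L B E Z W g G H)"
proof -
  note B = Hom_objs(2)[OF f] and E = Hom_objs(2)[OF g]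
  note iZ = Ident_closed[OF Z] and iW = Ident_closed[OF W]
  have F': "F \<in> Hom L (A \<times>\<^sub>o Y) (A \<times>\<^sub>o X)" and G': "G \<in> Hom L (B \<times>\<^sub>o Z) (B \<times>\<^sub>o Y)"
    and H': "H \<in> Hom L (E \<times>\<^sub>o W) (E \<times>\<^sub>o Z)"
    using F G H by (auto simp: left_legs_def)
  note p2 = Pr2_closed[OF B Y]
  note pAW = Pr1_closed[OF A W] and pBW = Pr1_closed[OF B W] and pAZ = Pr1_closed[OF A Z]
  note fZ = prod_arr_closed[OF f iZ] and fW = prod_arr_closed[OF f iW]
    and gW = prod_arr_closed[OF g iW] and fgW = prod_arr_closed[OF Comp_closed[OF f g] iW]
  let ?h = "(g \<times>\<^sub>m Ident L W) \<Zcomp> H \<Zcomp> Pr2 L E Z"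
  let ?k = "((f \<Zcomp> g) \<times>\<^sub>m Ident L W) \<Zcomp> H \<Zcomp> Pr2 L E Z"
  let ?c = "(f \<times>\<^sub>m Ident L Z) \<Zcomp> G \<Zcomp> Pr2 L B Y"
  let ?m = "\<langle>Pr1 L A W \<Zcomp> f, ?k\<rangle> \<Zcomp> G \<Zcomp> Pr2 L B Y"
  note gWH = Comp_closed[OF gW H'] and fgWH = Comp_closed[OF fgW H']
  note h = Comp_closed[OF gWH Pr2_closed[OF E Z]]
    and k = Comp_closed[OF fgWH Pr2_closed[OF E Z]]
  note fZG = Comp_closed[OF fZ G']
  note c = Comp_closed[OF fZG p2]
  note pk = Pairing_closed[OF pAW k] and ph = Pairing_closed[OF pBW h]
  have fh: "(f \<times>\<^sub>m Ident L W) \<Zcomp> ?h = ?k"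
    by (simp add: Comp_assoc[OF fW gWH Pr2_closed[OF E Z], symmetric]
        Comp_assoc[OF fW gW H', symmetric] prod_arr_Ident_Comp[OF f g W])
  have "\<langle>Pr1 L A W, ?k\<rangle> \<Zcomp> ?c = ?m"
    by (simp add: Comp_assoc[OF pk fZG p2, symmetric] Comp_assoc[OF pk fZ G', symmetric]
        Pairing_prod_arr[OF pAW k f iZ] Ident_right[OF k])
  then have l: "left_comp L A E Z W (f \<Zcomp> g) (left_comp L A B Y Z f F G) H = \<langle>Pr1 L A W, ?m\<rangle> \<Zcomp> F"
    by (simp add: left_comp_def Comp_assoc[OF pk Pairing_closed[OF pAZ c] F', symmetric]
        comp_Pairing[OF pk pAZ c] Pairing_Pr1[OF pAW k])
  have "(f \<times>\<^sub>m Ident L W) \<Zcomp> (\<langle>Pr1 L B W, ?h\<rangle> \<Zcomp> G) = \<langle>Pr1 L A W \<Zcomp> f, ?k\<rangle> \<Zcomp> G"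
    by (simp add: Comp_assoc[OF fW ph G', symmetric] comp_Pairing[OF fW pBW h] fh
        prod_arr_Pr1[OF f iW])
  then have "left_comp L A B Y W f F (left_comp L B E Z W g G H) = \<langle>Pr1 L A W, ?m\<rangle> \<Zcomp> F"
    by (simp add: left_comp_def)
  with l show ?thesis by simp
qed

lemma first_projection_inject:
  "first_projection L A X = first_projection L B Y \<longleftrightarrow> A = B \<and> X = Y"
  by (auto simp: first_projection_def)

theorem ELens_category: "category (ELens L)"
proof
  fix \<phi> assume "\<phi> \<in> Arr (ELens L)"
  then obtain A X B Y f F where "A \<in> Obj L" "X \<in> Obj L" "B \<in> Obj L" "Y \<in> Obj L"
    and \<phi>: "\<phi> = span_lens L A X B Y f F"
    by (rule ELens_Arr_cases)
  moreover have "Dom (ELens L) \<phi> = first_projection L A X" "Cod (ELens L) \<phi> = first_projection L B Y"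
    by (simp_all add: \<phi> ELens_def span_lens_def)
  ultimately show "Dom (ELens L) \<phi> \<in> Obj (ELens L)" "Cod (ELens L) \<phi> \<in> Obj (ELens L)"
    by (simp_all add: first_projection_in_ELens)
next
  fix p assume "p \<in> Obj (ELens L)"
  then obtain A X where "A \<in> Obj L" "X \<in> Obj L" "p = first_projection L A X"
    by (auto simp: Obj_ELens)
  then show "Ident (ELens L) p \<in> Hom (ELens L) p p"
    by (simp add: ELens_Ident span_lens_in_Hom Ident_closed left_legs_Ident)
next
  fix \<phi> \<psi> p q r assume "\<phi> \<in> Hom (ELens L) p q" "\<psi> \<in> Hom (ELens L) q r"
  then show "\<phi> \<Zcomp>\<^bsub>ELens L\<^esub> \<psi> \<in> Hom (ELens L) p r"
    by (elim ELens_Hom_cases)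
      (auto simp: first_projection_inject span_lens_Comp
        intro!: span_lens_in_Hom Comp_closed left_comp_closed)
next
  fix \<phi> \<psi> \<chi> p q r s
  assume "\<phi> \<in> Hom (ELens L) p q" "\<psi> \<in> Hom (ELens L) q r" "\<chi> \<in> Hom (ELens L) r s"
  then show "\<phi> \<Zcomp>\<^bsub>ELens L\<^esub> \<psi> \<Zcomp>\<^bsub>ELens L\<^esub> \<chi> = \<phi> \<Zcomp>\<^bsub>ELens L\<^esub> (\<psi> \<Zcomp>\<^bsub>ELens L\<^esub> \<chi>)"
    by (elim ELens_Hom_cases)
      (auto simp: first_projection_inject span_lens_Comp Comp_assoc left_comp_assoc)
next
  fix \<phi> p q assume "\<phi> \<in> Hom (ELens L) p q"
  then show "Ident (ELens L) p \<Zcomp>\<^bsub>ELens L\<^esub> \<phi> = \<phi>"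
    by (elim ELens_Hom_cases)
      (simp add: ELens_Ident span_lens_Comp Ident_left left_comp_Ident_left)
next
  fix \<phi> p q assume "\<phi> \<in> Hom (ELens L) p q"
  then show "\<phi> \<Zcomp>\<^bsub>ELens L\<^esub> Ident (ELens L) q = \<phi>"
    by (elim ELens_Hom_cases)
      (simp add: ELens_Ident span_lens_Comp Ident_right left_comp_Ident_right)
qed

end

section \<open>The cotangent functor\<close>

definition cotangent_lens :: "('o, 'm, 'x) reverse_diff_cat_scheme \<Rightarrow> 'm \<Rightarrow> ('o, 'm) lens"
  where "cotangent_lens L f =
    (let A = Dom L f; B = Cod L f
     in span_lens L A A B B f \<langle>Pr1 L A B, Rev L f\<rangle>\<^bsub>L\<^esub>)"

context cartesian_reverse_differential_category
begin

lemma cotangent_lens_span: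
  assumes "f \<in> Hom L A B"
  shows "cotangent_lens L f = span_lens L A A B B f \<langle>Pr1 L A B, Rev L f\<rangle>"
  using assms by (simp add: cotangent_lens_def Hom_def Let_def)

lemma cotangent_lens_closed:
  assumes f: "f \<in> Hom L A B"
  shows "cotangent_lens L f \<in> Hom (ELens L) (first_projection L A A) (first_projection L B B)"
proof -
  note A = Hom_objs(1)[OF f] and B = Hom_objs(2)[OF f]
  note p = Pr1_closed[OF A B] and r = Rev_closed[OF f]
  have "\<langle>Pr1 L A B, Rev L f\<rangle> \<in> left_legs L A A B"
    by (simp add: left_legs_def Pairing_closed[OF p r] Pairing_Pr1[OF p r])
  then show ?thesis
    by (simp add: cotangent_lens_span[OF f] span_lens_in_Hom A B f)
qed

lemma cotangent_lens_Ident: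
  assumes A: "A \<in> Obj L"
  shows "cotangent_lens L (Ident L A) = Ident (ELens L) (first_projection L A A)"
  by (simp add: cotangent_lens_span[OF Ident_closed[OF A]] Rev_Ident[OF A] Pairing_Pr1_Pr2[OF A A]
      ELens_Ident[OF A A])

text \<open>
  The projection \<open>\<pi>\<^sub>2\<close> in the composition of lenses extracts \<open>R g\<close> from the left leg
  \<open>\<langle>\<pi>\<^sub>1, R g\<rangle>\<close>; what is left is the reverse chain rule, paired with \<open>\<pi>\<^sub>1\<close>.
\<close>
lemma cotangent_lens_Comp:
  assumes f: "f \<in> Hom L A B" and g: "g \<in> Hom L B E"
  shows "cotangent_lens L (f \<Zcomp> g) = cotangent_lens L f \<Zcomp>\<^bsub>ELens L\<^esub> cotangent_lens L g"
proof -
  note A = Hom_objs(1)[OF f] and B = Hom_objs(2)[OF f] and E = Hom_objs(2)[OF g]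
  note pAE = Pr1_closed[OF A E] and pBE = Pr1_closed[OF B E] and pAB = Pr1_closed[OF A B]
  note Rf = Rev_closed[OF f] and Rg = Rev_closed[OF g]
  note fE = prod_arr_closed[OF f Ident_closed[OF E]]
  note b = Comp_closed[OF fE Rg]
  have Rg_leg: "(f \<times>\<^sub>m Ident L E) \<Zcomp> \<langle>Pr1 L B E, Rev L g\<rangle> \<Zcomp> Pr2 L B B = (f \<times>\<^sub>m Ident L E) \<Zcomp> Rev L g"
    by (simp add: Comp_assoc[OF fE Pairing_closed[OF pBE Rg] Pr2_closed[OF B B]]
        Pairing_Pr2[OF pBE Rg])
  have "left_comp L A B B E f \<langle>Pr1 L A B, Rev L f\<rangle> \<langle>Pr1 L B E, Rev L g\<rangle> =
      \<langle>Pr1 L A E, Rev L (f \<Zcomp> g)\<rangle>"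
    by (simp add: left_comp_def Rg_leg comp_Pairing[OF Pairing_closed[OF pAE b] pAB Rf]
        Pairing_Pr1[OF pAE b] Rev_Comp[OF f g])
  then show ?thesis
    by (simp add: cotangent_lens_span[OF f] cotangent_lens_span[OF g]
        cotangent_lens_span[OF Comp_closed[OF f g]] span_lens_Comp)
qed

lemma cotangent_functor:
  "cat_functor L (ELens L) (\<lambda>A. first_projection L A A) (cotangent_lens L)"
  by (intro cat_functor.intro cat_functor_axioms.intro category_axioms ELens_category
      first_projection_in_ELens cotangent_lens_closed cotangent_lens_Ident cotangent_lens_Comp)

end

theorem proposition3p7:
  fixes L :: "('o, 'm, 'x) reverse_diff_cat_scheme" (structure)
  assumes "cartesian_reverse_differential_category L"
  shows "\<exists>To Ta. cat_functor L (ELens L) To Ta \<and>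
    (\<forall>A \<in> Obj L. To A = first_projection L A A) \<and>
    (\<forall>A \<in> Obj L. \<forall>B \<in> Obj L. \<forall>f \<in> Hom L A B.
      Ta f = \<lparr>lens_src = first_projection L A A, lens_tgt = first_projection L B B,
              lens_base = f,
              lens_left = \<langle>Pr1 L A B, Rev L f\<rangle>,
              lens_right = f \<times>\<^sub>m Ident L B\<rparr>)"
proof -
  interpret cartesian_reverse_differential_category L
    by (rule assms)
  show ?thesis
    by (intro exI[of _ "\<lambda>A. first_projection L A A"] exI[of _ "cotangent_lens L"])
      (simp add: cotangent_functor cotangent_lens_span span_lens_def)
qed

end
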